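(* Let $\mathcal D$ be a doctrine on a finite set of literals $\Pi$. Assume that the valuation $v$ is an aggregate of partial truth assignments that are definitely consistent with $\mathcal D$, i.e. $v_p=\sum_k a_k v^k_p$ for all $p\in\Pi$, a finite sum with $a_k\ge0$, $\sum_k a_k=1$ and each $v^k$ a partial truth assignment definitely consistent with $\mathcal D$. Then for every $p\in\Pi$, having $v_p=1$ implies that $p$ is accepted by the basic decision associated with the upper revised valuation $v^*$, i.e. $v^*_p>v^*_{\overline p}$.
   Context: $\Pi_+$ is a finite nonempty set of atoms; $\Pi=\bigcup_{p\in\Pi_+}\{p,\overline p\}$ is the set of literals, where $p\mapsto\overline p$ is negation and $\overline{\overline p}=p$. A clause is a subset $C\subseteq\Pi$, read as the disjunction $\bigvee_{p\in C}p$. A doctrine is a collection $\mathcal D$ of clauses, read as the conjunctive normal form $\bigwedge_{C\in\mathcal D}\bigvee_{p\in C}p$. Standing assumptions: (D1) this formula is satisfiable; (D2) no clause in $\mathcal D$ consists of a single literal; (D3) $\{p,\overline p\}\in\mathcal D$ for every $p\in\Pi_+$. A valuation is a map $w:\Pi\to[0,1]$, $p\mapsto w_p$. For a valuation $v$ define $v'$ by $$v'_p=\max_{C\in\mathcal D,\ C\ni p}\ \min_{\alpha\in C,\ \alpha\neq p} v_{\overline\alpha}.$$ Put $v^{(0)}=v$ and $v^{(n+1)}=(v^{(n)})'$. This sequence is non-decreasing and takes values in the finite set $\{v_\alpha:\alpha\in\Pi\}$, so it is eventually constant; its eventual value is the upper revised valuation $v^*$. A partial truth assignment is a valuation $u$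 with values in $\{0,\tfrac12,1\}$ and $u_p+u_{\overline p}=1$ for all $p$. It is definitely consistent with $\mathcal D$ when, for each $C\in\mathcal D$ and every $p\in C$: if $u_\alpha=0$ for every $\alpha\in C\setminus\{p\}$, then $u_p=1$. The basic decision associated with a valuation $w$ accepts $p$ (and rejects $\overline p$) exactly when $w_p-w_{\overline p}>0$. *)

theory Defs
  imports Complex_Main
begin

datatype 'a lit = Pos 'a | Neg 'a

fun neg :: "'a lit \<Rightarrow> 'a lit" where
  "neg (Pos a) = Neg a"
| "neg (Neg a) = Pos a"

definition lits :: "'a set \<Rightarrow> 'a lit set" where
  "lits At = (\<Union>a\<in>At. {Pos a, neg (Pos a)})"

fun holds :: "('a \<Rightarrow> bool) \<Rightarrow> 'a lit \<Rightarrow> bool" where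
  "holds t (Pos a) \<longleftrightarrow> t a"
| "holds t (Neg a) \<longleftrightarrow> \<not> t a"

definition satisfiable :: "'a lit set set \<Rightarrow> bool" where
  "satisfiable D \<longleftrightarrow> (\<exists>t. \<forall>C\<in>D. \<exists>p\<in>C. holds t p)"

text \<open>The last three conjuncts are the standing assumptions on doctrines: the conjunctive normal
  form is satisfiable, no clause is a single literal, and every tertium non datur clause is
  included.\<close>

definition doctrine :: "'a set \<Rightarrow> 'a lit set set \<Rightarrow> bool" where
  "doctrine At D \<longleftrightarrow>
     (\<forall>C\<in>D. C \<subseteq> lits At) \<and>
     satisfiable D \<and>
     (\<forall>p. {p} \<notin> D) \<and>
     (\<forall>a\<in>At. {Pos a, neg (Pos a)} \<in> D)"

text \<open>Valuations are total functions; only their values on \<open>lits At\<close> are meaningful.\<close>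

definition valuation :: "'a set \<Rightarrow> ('a lit \<Rightarrow> real) \<Rightarrow> bool" where
  "valuation At w \<longleftrightarrow> (\<forall>p\<in>lits At. w p \<in> {0..1})"

text \<open>For a doctrine over a finite set of atoms and a literal over these atoms, the maximum and
  the minima range over finite nonempty sets: the clause \<open>{p, neg p}\<close> contains \<open>p\<close>, and no clause
  equals \<open>{p}\<close>.\<close>

definition revise :: "'a lit set set \<Rightarrow> ('a lit \<Rightarrow> real) \<Rightarrow> 'a lit \<Rightarrow> real" where
  "revise D v p = Max ((\<lambda>C. Min ((\<lambda>\<alpha>. v (neg \<alpha>)) ` (C - {p}))) ` {C \<in> D. p \<in> C})"

text \<open>The eventual value of the sequence of iterated revisions, which is eventually constant
  at every literal over the atoms of a doctrine.\<close>

definition upper_revised :: "'a lit set set \<Rightarrow> ('a lit \<Rightarrow> real) \<Rightarrow> 'a lit \<Rightarrow> real" where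
  "upper_revised D v p = (THE x. \<exists>N. \<forall>n\<ge>N. (revise D ^^ n) v p = x)"

definition partial_truth_assignment :: "'a set \<Rightarrow> ('a lit \<Rightarrow> real) \<Rightarrow> bool" where
  "partial_truth_assignment At u \<longleftrightarrow>
     valuation At u \<and> (\<forall>p\<in>lits At. u p \<in> {0, 1/2, 1} \<and> u p + u (neg p) = 1)"

definition definitely_consistent :: "'a lit set set \<Rightarrow> ('a lit \<Rightarrow> real) \<Rightarrow> bool" where
  "definitely_consistent D u \<longleftrightarrow>
     (\<forall>C\<in>D. \<forall>p\<in>C. (\<forall>\<alpha>\<in>C - {p}. u \<alpha> = 0) \<longrightarrow> u p = 1)"

definition accepted :: "('a lit \<Rightarrow> real) \<Rightarrow> 'a lit \<Rightarrow> bool" where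
  "accepted w p \<longleftrightarrow> w p - w (neg p) > 0"

end

(* Monotonicity of the iterates gives v*_p = 1, so only v*_(neg p) < 1 is at stake, and for this
   revision must create no new literal of value 1.  Now if v'_q = 1, then some clause C through q
   has v_(neg alpha) = 1 for every other alpha in C.  An average of numbers in [0,1] equals 1 only
   if every number of positive weight does, so each contributing assignment rejects all these alpha
   and hence, being definitely consistent, accepts q; thus v_q = 1. *)

theory Submission
  imports Defs
begin

lemma neg_neg [simp]: "neg (neg p) = p"
  by (cases p) auto

lemma neg_neq [simp]: "neg p \<noteq> p"
  by (cases p) auto

lemma neg_in_lits: "p \<in> lits At \<Longrightarrow> neg p \<in> lits At"
  by (cases p) (auto simp: lits_def)

lemma finite_lits: "finite At \<Longrightarrow> finite (lits At)"
  by (auto simp: lits_def)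

lemma finite_doctrine:
  assumes "finite At" "doctrine At D"
  shows "finite D"
proof (rule finite_subset)
  show "D \<subseteq> Pow (lits At)"
    using assms(2) by (auto simp: doctrine_def)
qed (simp add: finite_lits assms(1))

lemma doctrine_subset: "doctrine At D \<Longrightarrow> C \<in> D \<Longrightarrow> C \<subseteq> lits At"
  by (simp add: doctrine_def)

lemma doctrine_tertium_non_datur:
  assumes "doctrine At D" "p \<in> lits At"
  shows "{p, neg p} \<in> D"
  using assms by (auto simp: doctrine_def lits_def insert_commute)

lemma doctrine_clause_minus_nonempty:
  assumes "doctrine At D" "C \<in> D" "p \<in> C"
  shows "C - {p} \<noteq> {}"
proof
  assume "C - {p} = {}"
  with assms(3) have "C = {p}" by auto
  with assms(1,2) show False by (auto simp: doctrine_def)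
qed

text \<open>The maximum and minimum range over finite nonempty sets, so both are attained. The
  literal \<open>\<alpha>\<close> confines revised values to old ones, while the bounds for all
  \<open>\<beta>\<close> let a high revised value be traced back through the whole clause
  \<open>C\<close>.\<close>

lemma revise_attained:
  assumes "finite At" "doctrine At D" "p \<in> lits At"
  obtains C \<alpha> where "C \<in> D" "p \<in> C" "\<alpha> \<in> C - {p}" "revise D v p = v (neg \<alpha>)"
    "\<And>\<beta>. \<beta> \<in> C - {p} \<Longrightarrow> revise D v p \<le> v (neg \<beta>)"
proof -
  let ?M = "\<lambda>C. Min ((\<lambda>\<alpha>. v (neg \<alpha>)) ` (C - {p}))"
  have "{C \<in> D. p \<in> C} \<noteq> {}"
    using doctrine_tertium_non_datur[OF assms(2,3)] by auto
  then have "Max (?M ` {C \<in> D. p \<in> C}) \<in> ?M ` {C \<in> D. p \<in> C}"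
    using finite_doctrine[OF assms(1,2)] by (intro Max_in) auto
  then obtain C where C: "C \<in> D" "p \<in> C" "revise D v p = ?M C"
    unfolding revise_def by auto
  have fin: "finite (C - {p})"
    using finite_subset[OF doctrine_subset[OF assms(2) C(1)] finite_lits[OF assms(1)]] by simp
  then have "?M C \<in> (\<lambda>\<alpha>. v (neg \<alpha>)) ` (C - {p})"
    using doctrine_clause_minus_nonempty[OF assms(2) C(1,2)] by (intro Min_in) auto
  then obtain \<alpha> where "\<alpha> \<in> C - {p}" "?M C = v (neg \<alpha>)" by blast
  moreover have "?M C \<le> v (neg \<beta>)" if "\<beta> \<in> C - {p}" for \<beta>
    using fin that by (intro Min_le) auto
  ultimately show ?thesis
    using that C by metis
qed

text \<open>The tertium non datur clause \<open>{p, neg p}\<close> contributes exactly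
  \<open>v (neg (neg p))\<close>, that is \<open>v p\<close>, to the maximum.\<close>

lemma revise_ge:
  assumes "finite At" "doctrine At D" "p \<in> lits At"
  shows "v p \<le> revise D v p"
proof -
  let ?M = "\<lambda>C. Min ((\<lambda>\<alpha>. v (neg \<alpha>)) ` (C - {p}))"
  have "{p, neg p} - {p} = {neg p}" by auto
  then have "v p = ?M {p, neg p}" by simp
  also have "?M {p, neg p} \<le> revise D v p"
    unfolding revise_def
    using doctrine_tertium_non_datur[OF assms(2,3)] finite_doctrine[OF assms(1,2)]
    by (intro Max_ge imageI finite_imageI) auto
  finally show ?thesis .
qed

text \<open>Each revised value is an earlier value at some literal \<open>neg \<alpha>\<close>, so
  revision only moves values around. This gives both the stabilisation of the iterates and their
  bound by 1.\<close>

lemma iterated_revise_in_image: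
  assumes "finite At" "doctrine At D" "p \<in> lits At"
  shows "(revise D ^^ n) v p \<in> v ` lits At"
  using assms(3)
proof (induction n arbitrary: p)
  case (Suc n)
  obtain C \<alpha> where "C \<in> D" "\<alpha> \<in> C - {p}"
      and "revise D ((revise D ^^ n) v) p = (revise D ^^ n) v (neg \<alpha>)"
    using revise_attained[OF assms(1,2) Suc.prems] by metis
  moreover from this have "neg \<alpha> \<in> lits At"
    using doctrine_subset[OF assms(2)] neg_in_lits by blast
  ultimately show ?case
    using Suc.IH by simp
qed auto

lemma incseq_finite_range_eventually_const:
  fixes f :: "nat \<Rightarrow> 'a::linorder"
  assumes "incseq f" "finite (range f)"
  obtains N where "\<And>n. n \<ge> N \<Longrightarrow> f n = f N"
proof -
  have "Max (range f) \<in> range f"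
    using assms(2) by (intro Max_in) auto
  then obtain N where "f N = Max (range f)" by (metis imageE)
  then have "f n = f N" if "n \<ge> N" for n
    using that assms by (metis Max_ge antisym incseq_def rangeI)
  then show ?thesis using that by blast
qed

text \<open>Turns the definite description into a concrete iterate, so that facts about all iterates
  carry over. The stage \<open>N\<close> may depend on \<open>p\<close>.\<close>

lemma upper_revised_eq_iterate:
  assumes "finite At" "doctrine At D" "p \<in> lits At"
  obtains N where "upper_revised D v p = (revise D ^^ N) v p"
proof -
  let ?f = "\<lambda>n. (revise D ^^ n) v p"
  have "incseq ?f"
    using revise_ge[OF assms] by (intro incseq_SucI) simp
  moreover have "finite (range ?f)"
    by (rule finite_subset[of _ "v ` lits At"])
      (use iterated_revise_in_image[OF assms] finite_lits[OF assms(1)] in auto)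
  ultimately obtain N where N: "\<And>n. n \<ge> N \<Longrightarrow> ?f n = ?f N"
    using incseq_finite_range_eventually_const by blast
  have "upper_revised D v p = ?f N"
    unfolding upper_revised_def
  proof (rule the_equality)
    show "\<exists>N'. \<forall>n\<ge>N'. ?f n = ?f N" using N by blast
  next
    fix x assume "\<exists>N'. \<forall>n\<ge>N'. ?f n = x"
    then obtain N' where "\<And>n. n \<ge> N' \<Longrightarrow> ?f n = x" by blast
    \<comment> \<open>Both eventual values are read off at the common index
      \<open>max N N'\<close>.\<close>
    then show "x = ?f N" using N by (metis max.cobounded1 max.cobounded2)
  qed
  then show ?thesis using that by blast
qed

lemma iterated_revise_ge:
  assumes "finite At" "doctrine At D" "p \<in> lits At"
  shows "v p \<le> (revise D ^^ n) v p"
proof (induction n)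
  case (Suc n)
  then show ?case
    using revise_ge[OF assms, of "(revise D ^^ n) v"] by simp
qed simp

text \<open>The premise \<open>closed\<close> says that the literals of value 1 are closed under
  unit propagation. Tracing a value 1 back one revision yields a clause whose other literals have
  negations of value 1 one stage earlier, hence in \<open>v\<close> by induction.\<close>

lemma iterated_revise_eq_one:
  assumes "finite At" "doctrine At D" "valuation At v" "p \<in> lits At"
    and closed: "\<And>C p. C \<in> D \<Longrightarrow> p \<in> C \<Longrightarrow> (\<And>\<beta>. \<beta> \<in> C - {p} \<Longrightarrow> v (neg \<beta>) = 1) \<Longrightarrow> v p = 1"
    and "(revise D ^^ n) v p = 1"
  shows "v p = 1"
  using assms(4,6)
proof (induction n arbitrary: p)
  case (Suc n)
  let ?w = "(revise D ^^ n) v"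
  obtain C where C: "C \<in> D" "p \<in> C"
      and le: "\<And>\<beta>. \<beta> \<in> C - {p} \<Longrightarrow> revise D ?w p \<le> ?w (neg \<beta>)"
    using revise_attained[OF assms(1,2) Suc.prems(1)] by metis
  have "v (neg \<beta>) = 1" if \<beta>: "\<beta> \<in> C - {p}" for \<beta>
  proof -
    have lit: "neg \<beta> \<in> lits At"
      using \<beta> doctrine_subset[OF assms(2) C(1)] neg_in_lits by blast
    have "?w (neg \<beta>) \<le> 1"
      using iterated_revise_in_image[OF assms(1,2) lit, where n = n and v = v] assms(3)
      by (auto simp: valuation_def)
    moreover have "1 \<le> ?w (neg \<beta>)"
      using le[OF \<beta>] Suc.prems(2) by simp
    ultimately show ?thesis
      using Suc.IH lit by (simp add: antisym)
  qed
  then show ?case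
    using closed C by blast
qed simp

text \<open>As the weights sum to 1, the equation says that the nonnegative terms
  \<open>a k * (1 - x k)\<close> sum to 0, so each of them vanishes.\<close>

lemma convex_combination_eq_one_iff:
  fixes a x :: "'k \<Rightarrow> real"
  assumes "finite K" "\<And>k. k \<in> K \<Longrightarrow> a k \<ge> 0" "(\<Sum>k\<in>K. a k) = 1" "\<And>k. k \<in> K \<Longrightarrow> x k \<le> 1"
  shows "(\<Sum>k\<in>K. a k * x k) = 1 \<longleftrightarrow> (\<forall>k\<in>K. a k \<noteq> 0 \<longrightarrow> x k = 1)"
proof -
  have "(\<Sum>k\<in>K. a k * x k) = 1 \<longleftrightarrow> (\<Sum>k\<in>K. a k * (1 - x k)) = 0"
    using assms(3) by (simp add: right_diff_distrib sum_subtractf)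
  also have "\<dots> \<longleftrightarrow> (\<forall>k\<in>K. a k * (1 - x k) = 0)"
    using assms by (intro sum_nonneg_eq_0_iff) auto
  finally show ?thesis by auto
qed

theorem theorem3p11:
  fixes At :: "'a set" and D :: "'a lit set set" and v :: "'a lit \<Rightarrow> real"
    and K :: "'k set" and a :: "'k \<Rightarrow> real" and u :: "'k \<Rightarrow> 'a lit \<Rightarrow> real"
  assumes "finite At" and "At \<noteq> {}"
    and "doctrine At D"
    and "valuation At v"
    and "finite K"
    and "\<And>k. k \<in> K \<Longrightarrow> a k \<ge> 0"
    and "(\<Sum>k\<in>K. a k) = 1"
    and "\<And>k. k \<in> K \<Longrightarrow> partial_truth_assignment At (u k)"
    and "\<And>k. k \<in> K \<Longrightarrow> definitely_consistent D (u k)"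
    and "\<And>p. p \<in> lits At \<Longrightarrow> v p = (\<Sum>k\<in>K. a k * u k p)"
  shows "\<forall>p\<in>lits At. v p = 1 \<longrightarrow> accepted (upper_revised D v) p"
proof (intro ballI impI)
  fix p assume p: "p \<in> lits At" and "v p = 1"
  have le_one: "u k q \<le> 1" and compl: "u k q + u k (neg q) = 1"
    if "k \<in> K" "q \<in> lits At" for k q
    using assms(8)[OF that(1)] that(2) by (auto simp: partial_truth_assignment_def valuation_def)
  have one_iff: "v q = 1 \<longleftrightarrow> (\<forall>k\<in>K. a k \<noteq> 0 \<longrightarrow> u k q = 1)" if "q \<in> lits At" for q
    unfolding assms(10)[OF that]
    using convex_combination_eq_one_iff[OF assms(5-7)] le_one that by simp
  \<comment> \<open>Unit propagation passes to the aggregate: by \<open>one_iff\<close>, certainty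
    in \<open>v\<close> is certainty in every assignment of positive weight, and each of these
    propagates by definite consistency.\<close>
  have closed: "v q = 1"
    if C: "C \<in> D" "q \<in> C" and others: "\<And>\<beta>. \<beta> \<in> C - {q} \<Longrightarrow> v (neg \<beta>) = 1" for C q
  proof -
    have lits: "C \<subseteq> lits At"
      using doctrine_subset[OF assms(3) C(1)] .
    have "u k q = 1" if k: "k \<in> K" "a k \<noteq> 0" for k
    proof -
      have "u k \<beta> = 0" if \<beta>: "\<beta> \<in> C - {q}" for \<beta>
      proof -
        have "\<beta> \<in> lits At" using \<beta> lits by auto
        moreover from this have "u k (neg \<beta>) = 1"
          using others[OF \<beta>] one_iff neg_in_lits k by blast
        ultimately show ?thesis
          using compl[OF k(1), of \<beta>] by simp
      qed
      then show ?thesis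
        using assms(9)[OF k(1)] C unfolding definitely_consistent_def by blast
    qed
    then show ?thesis using one_iff C(2) lits by blast
  qed
  \<comment> \<open>Complementarity of the assignments is inherited by their average, so certainty
    of \<open>p\<close> excludes certainty of \<open>neg p\<close>.\<close>
  have "v p + v (neg p) = (\<Sum>k\<in>K. a k * (u k p + u k (neg p)))"
    using assms(10) p neg_in_lits[OF p] by (simp add: distrib_left sum.distrib)
  also have "\<dots> = 1"
    using compl p assms(7) by simp
  finally have "v (neg p) \<noteq> 1" using \<open>v p = 1\<close> by simp
  \<comment> \<open>The stages \<open>m\<close> and \<open>n\<close> may differ; this is harmless
    because the two iterates are compared only through the threshold 1.\<close>
  obtain m where m: "upper_revised D v p = (revise D ^^ m) v p"
    using upper_revised_eq_iterate[OF assms(1,3) p] by blast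
  obtain n where n: "upper_revised D v (neg p) = (revise D ^^ n) v (neg p)"
    using upper_revised_eq_iterate[OF assms(1,3) neg_in_lits[OF p]] by blast
  have "(revise D ^^ n) v (neg p) \<noteq> 1"
  proof
    assume "(revise D ^^ n) v (neg p) = 1"
    with closed have "v (neg p) = 1"
      by (rule iterated_revise_eq_one[OF assms(1,3,4) neg_in_lits[OF p]])
    with \<open>v (neg p) \<noteq> 1\<close> show False by contradiction
  qed
  moreover have "(revise D ^^ n) v (neg p) \<le> 1"
    using iterated_revise_in_image[OF assms(1,3) neg_in_lits[OF p], where n = n and v = v] assms(4)
    by (auto simp: valuation_def)
  moreover have "1 \<le> (revise D ^^ m) v p"
    using iterated_revise_ge[OF assms(1,3) p, of v m] \<open>v p = 1\<close> by simp
  ultimately show "accepted (upper_revised D v) p"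
    by (simp add: accepted_def m n)
qed

end
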